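(* Let $m\geq 3$ and let $\mathcal{G}_\alpha$ be the generalized Green's function of the cycle $C_m$ with vertices $0,1,\ldots,m-1$. Let $\alpha\in\mathbb{C}$, $\alpha\neq0$, and let $r\in\mathbb{C}\setminus\{0\}$ satisfy $2(1+\alpha)=r+r^{-1}$. Then for all $0\le x,y\le m-1$ (whenever the right-hand side is defined), $$\mathcal{G}_\alpha(x,y)=-\frac{2}{m(r+r^{-1}-2)}+\frac{2\left(r^{m/2-|x-y|}+r^{-m/2+|x-y|}\right)}{(r-r^{-1})(r^{m/2}-r^{-m/2})}.$$
   Context: $C_m$ is the cycle on $\{0,\ldots,m-1\}$ with $x\sim y$ iff $y\equiv x\pm1\pmod m$; its normalized Laplacian $\mathcal{L}$ has $\mathcal{L}(x,x)=1$, $\mathcal{L}(x,y)=-1/2$ if $x\sim y$, $0$ otherwise. For an orthonormal eigensystem $\{(\lambda_j,\phi_j)\}$ of $\mathcal{L}$ (complex eigenvectors allowed), the generalized Green's function is $\mathcal{G}_\alpha(x,y)=\sum_{j:\lambda_j>0}\frac{1}{\lambda_j+\alpha}\phi_j(x)\overline{\phi_j(y)}$, defined for $\alpha\in\mathbb{C}$ with $-\alpha$ not a positive eigenvalue; equivalently the symmetric matrix with $(\mathcal{L}+\alpha)\mathcal{G}_\alpha=I-\frac1mJ$ and $\mathcal{G}_\alpha J=0$ ($J$ the all-ones matrix). Half-integer powers are interpreted as $r^{k/2}:=s^k$ for a fixed square root $s$ of $r$; the right-hand side does not depend on the choice of $s$ nor on replacing $r$ by $r^{-1}$. *)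

theory Defs
  imports
    "HOL-Number_Theory.Cong"
    "Jordan_Normal_Form.Char_Poly"
    "Jordan_Normal_Form.Conjugate"
begin

definition cycle_adj :: "nat \<Rightarrow> nat \<Rightarrow> nat \<Rightarrow> bool" where
  "cycle_adj m x y \<longleftrightarrow>
     [int y = int x + 1] (mod int m) \<or> [int y = int x - 1] (mod int m)"

definition cycle_laplacian :: "nat \<Rightarrow> complex mat" where
  "cycle_laplacian m =
     mat m m (\<lambda>(x, y). if x = y then 1 else if cycle_adj m x y then - 1 / 2 else 0)"

text \<open>The eigensystem is listed with multiplicity as \<open>(\<mu> j, \<phi> j)\<close> for \<open>j < dim_row A\<close>.
  Taking the eigenvalues to be real loses nothing for a Hermitian matrix.\<close>

definition orthonormal_eigensystem ::
    "complex mat \<Rightarrow> (nat \<Rightarrow> real) \<Rightarrow> (nat \<Rightarrow> complex vec) \<Rightarrow> bool" where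
  "orthonormal_eigensystem A \<mu> \<phi> \<longleftrightarrow>
     (\<forall>j < dim_row A. eigenvector A (\<phi> j) (complex_of_real (\<mu> j))) \<and>
     (\<forall>i < dim_row A. \<forall>j < dim_row A. \<phi> i \<bullet>c \<phi> j = (if i = j then 1 else 0))"

text \<open>Meaningful only if \<open>- \<alpha>\<close> is not one of the positive \<open>\<mu> j\<close>.\<close>

definition gen_green ::
    "nat \<Rightarrow> (nat \<Rightarrow> real) \<Rightarrow> (nat \<Rightarrow> complex vec) \<Rightarrow> complex \<Rightarrow> complex mat" where
  "gen_green n \<mu> \<phi> \<alpha> =
     mat n n (\<lambda>(x, y). \<Sum>j | j < n \<and> \<mu> j > 0.
       1 / (complex_of_real (\<mu> j) + \<alpha>) * (\<phi> j $ x) * cnj (\<phi> j $ y))"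

end

theory Submission
  imports Defs
begin

text \<open>
  The second summand of the right-hand side, as a kernel in \<open>x\<close> and \<open>y\<close>, is the inverse of
  \<open>L + \<alpha>\<close>: with \<open>h k = c * (s powi (m - 2 * k) + s powi (2 * k - m))\<close> one has
  \<open>h (m - k) = h k\<close> and \<open>h (k + 1) + h (k - 1) = 2 * (1 + \<alpha>) * h k\<close>, and \<open>c\<close> is normalised by
  \<open>h (-1) - h 1 = 2\<close>. The resolution of the identity \<open>(\<Sum>j. \<phi> j x * cnj (\<phi> j y)) = \<delta> x y\<close> therefore
  expands this kernel as \<open>\<Sum>j. \<phi> j x * cnj (\<phi> j y) / (\<mu> j + \<alpha>)\<close>. By the Dirichlet form, an
  eigenfunction with \<open>\<mu> j \<le> 0\<close> is constant and has \<open>\<mu> j = 0\<close>, so these terms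
  contribute \<open>1 / (m * \<alpha>)\<close>, which is the first summand.
\<close>

section \<open>Neighbours and the Laplacian of the cycle\<close>

lemma cycle_adj_iff:
  assumes "m \<ge> 3" "x < m" "y < m"
  shows "cycle_adj m x y \<longleftrightarrow> y = (x + 1) mod m \<or> y = (x + m - 1) mod m"
proof -
  have 1: "[int y = int x + 1] (mod int m) \<longleftrightarrow> y = (x + 1) mod m"
  proof -
    have "[int y = int x + 1] (mod int m) \<longleftrightarrow> [int y = int (x + 1)] (mod int m)"
      by (simp add: add.commute)
    also have "\<dots> \<longleftrightarrow> y = (x + 1) mod m"
      using assms by (simp only: cong_int_iff) (simp add: cong_def)
    finally show ?thesis .
  qed
  have 2: "[int y = int x - 1] (mod int m) \<longleftrightarrow> y = (x + m - 1) mod m"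
  proof -
    have "int (x + m - 1) = (int x - 1) + int m"
      using assms by (simp add: of_nat_diff)
    then have "[int y = int x - 1] (mod int m) \<longleftrightarrow> [int y = int (x + m - 1)] (mod int m)"
      by (simp add: cong_def)
    also have "\<dots> \<longleftrightarrow> y = (x + m - 1) mod m"
      using assms by (simp only: cong_int_iff) (simp add: cong_def)
    finally show ?thesis .
  qed
  show ?thesis unfolding cycle_adj_def 1 2 ..
qed

lemma cycle_succ_mod: "x < m \<Longrightarrow> (x + 1) mod m = (if x = m - 1 then 0 else x + 1)" for m :: nat
  by (cases "x = m - 1") auto

lemma cycle_pred_mod: "x < m \<Longrightarrow> (x + m - 1) mod m = (if x = 0 then m - 1 else x - 1)" for m :: nat
proof (cases "x = 0")
  case False
  assume "x < m"
  with False have "x + m - 1 = (x - 1) + m" "x - 1 < m" by auto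
  then show ?thesis using False by (simp only: if_False mod_add_self2 mod_less)
qed simp

text \<open>Rotation by one step permutes the vertices. On the cycle this plays the part of
  summation by parts, without boundary terms.\<close>

lemma sum_cycle_succ:
  fixes f :: "nat \<Rightarrow> 'a::comm_monoid_add"
  assumes "m > 0"
  shows "(\<Sum>x<m. f ((x + 1) mod m)) = (\<Sum>x<m. f x)"
  by (rule sum.reindex_bij_witness[where i = "\<lambda>x. (x + m - 1) mod m" and j = "\<lambda>x. (x + 1) mod m"])
     (use assms in \<open>auto simp only: lessThan_iff cycle_succ_mod cycle_pred_mod split: if_splits\<close>)

lemma cycle_pred_succ: "x < m \<Longrightarrow> ((x + 1) mod m + m - 1) mod m = x" for m :: nat
  by (subst cycle_pred_mod) (auto simp only: cycle_succ_mod split: if_splits)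

lemma cycle_laplacian_row_sum:
  assumes "m \<ge> 3" "x < m"
  shows "(\<Sum>y<m. cycle_laplacian m $$ (x, y) * f y) =
    f x - (f ((x + 1) mod m) + f ((x + m - 1) mod m)) / 2"
proof -
  let ?p = "(x + 1) mod m" and ?q = "(x + m - 1) mod m"
  have lt: "?p < m" "?q < m" using assms by auto
  \<comment> \<open>Here \<open>m \<ge> 3\<close> matters: for \<open>m = 2\<close> the two
    neighbours coincide, and the row would contain the entry -1/2 only once.\<close>
  have ne: "?p \<noteq> x" "?q \<noteq> x" "?p \<noteq> ?q"
    using assms by (simp_all only: cycle_succ_mod cycle_pred_mod split: if_splits) auto
  have "(\<Sum>y<m. cycle_laplacian m $$ (x, y) * f y) =
    (\<Sum>y<m. (if y = x then f x else 0) + (if y = ?p then - f ?p / 2 else 0)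
       + (if y = ?q then - f ?q / 2 else 0))"
    using assms ne
    by (intro sum.cong refl) (auto simp: cycle_laplacian_def cycle_adj_iff)
  also have "\<dots> = f x - f ?p / 2 - f ?q / 2"
    using assms lt by (simp add: sum.distrib del: One_nat_def)
  finally show ?thesis by (simp add: add_divide_distrib)
qed

lemma cycle_laplacian_sym:
  assumes "x < m" "y < m"
  shows "cycle_laplacian m $$ (x, y) = cycle_laplacian m $$ (y, x)"
proof -
  have *: "[a = b + 1] (mod k) \<longleftrightarrow> [b = a - 1] (mod k)" for a b k :: int
    by (metis add_diff_cancel_right' cong_add_rcancel cong_sym_eq diff_add_cancel)
  have "cycle_adj m x y \<longleftrightarrow> cycle_adj m y x"
    unfolding cycle_adj_def using * by blast
  then show ?thesis using assms by (simp add: cycle_laplacian_def eq_commute)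
qed

section \<open>The Dirichlet form and nonpositive eigenvalues\<close>

lemma cycle_dirichlet_form:
  fixes f :: "nat \<Rightarrow> complex"
  assumes "m > 0"
  shows "(\<Sum>x<m. cnj (f x) * (f x - (f ((x + 1) mod m) + f ((x + m - 1) mod m)) / 2)) =
    of_real ((\<Sum>x<m. (cmod (f x - f ((x + 1) mod m)))\<^sup>2) / 2)"
proof -
  let ?s = "\<lambda>x. (x + 1) mod m"
  \<comment> \<open>Rotating the backward cross term gives the conjugate partner of the forward one.
    Together they are the mixed terms of the expanded squares.\<close>
  have A: "(\<Sum>x<m. cnj (f x) * f ((x + m - 1) mod m)) = (\<Sum>x<m. cnj (f (?s x)) * f x)"
  proof -
    have "(\<Sum>x<m. cnj (f x) * f ((x + m - 1) mod m)) =
        (\<Sum>x<m. cnj (f (?s x)) * f ((?s x + m - 1) mod m))"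
      using sum_cycle_succ[OF assms, of "\<lambda>x. cnj (f x) * f ((x + m - 1) mod m)"] by (rule sym)
    also have "\<dots> = (\<Sum>x<m. cnj (f (?s x)) * f x)"
      by (intro sum.cong refl) (simp only: cycle_pred_succ lessThan_iff)
    finally show ?thesis .
  qed
  have B: "(\<Sum>x<m. cnj (f (?s x)) * f (?s x)) = (\<Sum>x<m. cnj (f x) * f x)"
    by (rule sum_cycle_succ[OF assms, of "\<lambda>x. cnj (f x) * f x"])
  have "of_real ((\<Sum>x<m. (cmod (f x - f (?s x)))\<^sup>2) / 2) =
      (\<Sum>x<m. (f x - f (?s x)) * cnj (f x - f (?s x))) / 2"
    by (simp add: complex_norm_square del: of_real_power complex_cnj_diff)
  also have "\<dots> = ((\<Sum>x<m. cnj (f x) * f x) + (\<Sum>x<m. cnj (f (?s x)) * f (?s x))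
      - (\<Sum>x<m. cnj (f x) * f (?s x)) - (\<Sum>x<m. cnj (f (?s x)) * f x)) / 2"
    by (simp add: sum.distrib sum_subtractf algebra_simps)
  also have "\<dots> = (\<Sum>x<m. cnj (f x) * f x) - ((\<Sum>x<m. cnj (f x) * f (?s x))
      + (\<Sum>x<m. cnj (f x) * f ((x + m - 1) mod m))) / 2"
    unfolding A B by (simp add: field_simps)
  also have "\<dots> = (\<Sum>x<m. cnj (f x) * (f x - (f (?s x) + f ((x + m - 1) mod m)) / 2))"
    by (simp add: sum.distrib sum_subtractf algebra_simps sum_divide_distrib add_divide_distrib
          del: One_nat_def)
  finally show ?thesis by (rule sym)
qed

text \<open>Pairing the eigenvalue equation with \<open>f\<close> equates the nonnegative Dirichlet
  form with \<open>\<mu>\<close> times the squared norm, which is nonpositive. Both vanish, so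
  \<open>f\<close> does not change along any edge, and induction along the path from 0
  finishes.\<close>

lemma cycle_nonpos_eigenfunction_constant:
  fixes f :: "nat \<Rightarrow> complex" and \<mu> :: real
  assumes "m > 0" "\<mu> \<le> 0"
    and ev: "\<And>x. x < m \<Longrightarrow> f x - (f ((x + 1) mod m) + f ((x + m - 1) mod m)) / 2 = of_real \<mu> * f x"
    and x: "x < m"
  shows "f x = f 0"
proof -
  have "complex_of_real ((\<Sum>x<m. (cmod (f x - f ((x + 1) mod m)))\<^sup>2) / 2) =
      (\<Sum>x<m. cnj (f x) * (of_real \<mu> * f x))"
    unfolding cycle_dirichlet_form[OF \<open>m > 0\<close>, symmetric]
    by (intro sum.cong refl) (simp only: ev lessThan_iff)
  also have "\<dots> = of_real (\<mu> * (\<Sum>x<m. (cmod (f x))\<^sup>2))"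
    by (simp add: complex_norm_square sum_distrib_left mult_ac del: of_real_power)
  finally have "(\<Sum>x<m. (cmod (f x - f ((x + 1) mod m)))\<^sup>2) / 2 = \<mu> * (\<Sum>x<m. (cmod (f x))\<^sup>2)"
    by (simp only: of_real_eq_iff)
  moreover have "\<mu> * (\<Sum>x<m. (cmod (f x))\<^sup>2) \<le> 0"
    using \<open>\<mu> \<le> 0\<close> by (intro mult_nonpos_nonneg sum_nonneg) auto
  moreover have "(\<Sum>x<m. (cmod (f x - f ((x + 1) mod m)))\<^sup>2) \<ge> 0"
    by (intro sum_nonneg) auto
  ultimately have zero: "(\<Sum>x<m. (cmod (f x - f ((x + 1) mod m)))\<^sup>2) = 0"
    by linarith
  have step: "f x = f ((x + 1) mod m)" if "x < m" for x
  proof -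
    have "(cmod (f x - f ((x + 1) mod m)))\<^sup>2 = 0"
      by (rule sum_nonneg_0[OF _ _ zero]) (use that in simp_all)
    then have "f x - f ((x + 1) mod m) = 0"
      by (simp only: power_eq_0_iff norm_eq_zero)
    then show ?thesis by (simp only: right_minus_eq)
  qed
  show ?thesis using x
  proof (induction x)
    case (Suc x)
    with step[of x] show ?case by simp
  qed simp
qed

section \<open>Resolution of the identity\<close>

lemma orthonormal_family_complete:
  fixes \<phi> :: "nat \<Rightarrow> complex vec"
  assumes car: "\<And>j. j < n \<Longrightarrow> \<phi> j \<in> carrier_vec n"
    and orth: "\<And>i j. i < n \<Longrightarrow> j < n \<Longrightarrow> \<phi> i \<bullet>c \<phi> j = (if i = j then 1 else 0)"
    and xy: "x < n" "y < n"
  shows "(\<Sum>j<n. \<phi> j $ x * cnj (\<phi> j $ y)) = (if x = y then 1 else 0)"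
proof -
  define U where "U = mat n n (\<lambda>(i, j). \<phi> j $ i)"
  define V where "V = mat n n (\<lambda>(i, j). cnj (\<phi> i $ j))"
  have U: "U \<in> carrier_mat n n" and V: "V \<in> carrier_mat n n"
    by (auto simp: U_def V_def)
  have "V * U = 1\<^sub>m n"
  proof (rule eq_matI)
    fix i j assume "i < dim_row (1\<^sub>m n)" "j < dim_col (1\<^sub>m n)"
    then have ij: "i < n" "j < n" by auto
    have "(V * U) $$ (i, j) = \<phi> j \<bullet>c \<phi> i"
      using ij car[of i] by (auto simp: U_def V_def scalar_prod_def mult.commute intro!: sum.cong)
    then show "(V * U) $$ (i, j) = 1\<^sub>m n $$ (i, j)"
      using orth[of j i] ij by auto
  qed (auto simp: U_def V_def)
  \<comment> \<open>A left inverse of a square matrix is also a right inverse. Read entrywise, this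
    turns orthonormality of the columns into completeness.\<close>
  then have "U * V = 1\<^sub>m n"
    using mat_mult_left_right_inverse[OF V U] by simp
  then have "(U * V) $$ (x, y) = (if x = y then 1 else 0)"
    using xy by simp
  then show ?thesis
    using xy by (simp add: U_def V_def scalar_prod_def atLeast0LessThan)
qed

section \<open>The resolvent kernel, with half-integer powers of r written as powers of a square
  root s\<close>

definition cycle_resolvent :: "nat \<Rightarrow> complex \<Rightarrow> nat \<Rightarrow> nat \<Rightarrow> complex" where
  "cycle_resolvent m s x y =
    2 * (s powi (int m - 2 * \<bar>int x - int y\<bar>) + s powi (- int m + 2 * \<bar>int x - int y\<bar>)) /
      ((s\<^sup>2 - inverse (s\<^sup>2)) * (s powi int m - s powi (- int m)))"

text \<open>For fixed \<open>x\<close>, the kernel solves \<open>(L + \<alpha>) h = \<delta>\<close>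
  in its second argument. Off the diagonal this is the recurrence for \<open>h\<close>; the kink of
  the absolute value at distance 0 produces the delta.\<close>

lemma cycle_resolvent_equation:
  fixes s \<alpha> :: complex
  assumes "x < m" "z < m" "s \<noteq> 0"
    and \<alpha>: "2 * (1 + \<alpha>) = s\<^sup>2 + inverse (s\<^sup>2)"
    and nz: "s\<^sup>2 - inverse (s\<^sup>2) \<noteq> 0" "s powi int m - s powi (- int m) \<noteq> 0"
  shows "(1 + \<alpha>) * cycle_resolvent m s x z
      - (cycle_resolvent m s x ((z + 1) mod m) + cycle_resolvent m s x ((z + m - 1) mod m)) / 2
    = (if z = x then 1 else 0)"
proof -
  define D where "D = (s\<^sup>2 - inverse (s\<^sup>2)) * (s powi int m - s powi (- int m))"
  define h where "h k = 2 * (s powi (int m - 2 * k) + s powi (- int m + 2 * k)) / D" for k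
  have D: "D \<noteq> 0" using nz by (simp add: D_def)
  have H: "cycle_resolvent m s x y = h \<bar>int x - int y\<bar>" for y
    by (simp add: cycle_resolvent_def h_def D_def)
  have mirror: "h (int m - k) = h k" for k
    by (simp add: h_def algebra_simps)
  have shift: "s powi (k + 2) = s powi k * s\<^sup>2" "s powi (k - 2) = s powi k * inverse (s\<^sup>2)" for k
    using \<open>s \<noteq> 0\<close> by (simp_all add: power_int_add power_int_diff field_simps)
  have e: "int m - 2 * (k + 1) = (int m - 2 * k) - 2" "int m - 2 * (k - 1) = (int m - 2 * k) + 2"
    "- int m + 2 * (k + 1) = (- int m + 2 * k) + 2" "- int m + 2 * (k - 1) = (- int m + 2 * k) - 2"
    for k by simp_all
  have rec: "h (k + 1) + h (k - 1) = 2 * (1 + \<alpha>) * h k" for k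
    unfolding h_def e shift \<alpha> using D by (simp add: field_simps)
  \<comment> \<open>The sums \<open>0 - 1\<close> and \<open>0 + 1\<close> are left unevaluated so
    that \<open>e\<close> applies with \<open>k = 0\<close>. The difference of the numerators then
    factors as \<open>2 * D\<close>.\<close>
  have jump: "h (0 - 1) - h (0 + 1) = 2"
  proof -
    have "h (0 - 1) - h (0 + 1) = 2 * D / D"
      unfolding h_def e shift by (simp add: D_def algebra_simps diff_divide_distrib add_divide_distrib)
    then show ?thesis using D by simp
  qed
  \<comment> \<open>Across the seam between \<open>m - 1\<close> and 0 a distance \<open>k\<close>
    turns into \<open>m - k\<close>, which \<open>h\<close> does not see by \<open>mirror\<close>.
    After \<open>S\<close> and \<open>P\<close>, only steps on the integer line remain.\<close>
  have S: "cycle_resolvent m s x ((z + 1) mod m) = h \<bar>int z + 1 - int x\<bar>"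
  proof (cases "z = m - 1")
    case True
    then have "(z + 1) mod m = 0" "\<bar>int z + 1 - int x\<bar> = int m - int x"
      using assms(1) by auto
    then show ?thesis using mirror[of "int x"] by (simp add: H)
  next
    case False
    then have "(z + 1) mod m = z + 1" using assms by simp
    then have "\<bar>int x - int ((z + 1) mod m)\<bar> = \<bar>int z + 1 - int x\<bar>" by simp
    then show ?thesis by (simp only: H)
  qed
  have P: "cycle_resolvent m s x ((z + m - 1) mod m) = h \<bar>int z - 1 - int x\<bar>"
  proof (cases "z = 0")
    case True
    have "\<bar>int x - int ((z + m - 1) mod m)\<bar> = int m - (int x + 1)"
      using assms True by (simp add: of_nat_diff)
    moreover have "\<bar>int z - 1 - int x\<bar> = int x + 1" using True by simp
    ultimately show ?thesis using mirror[of "int x + 1"] by (simp only: H)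
  next
    case False
    then have "(z + m - 1) mod m = z - 1" using assms(2) by (simp only: cycle_pred_mod if_False)
    then have "\<bar>int x - int ((z + m - 1) mod m)\<bar> = \<bar>int z - 1 - int x\<bar>"
      using False by (simp add: of_nat_diff)
    then show ?thesis by (simp only: H)
  qed
  define k where "k = \<bar>int x - int z\<bar>"
  consider "z = x" | "z > x" | "z < x" by linarith
  then show ?thesis
  proof cases
    case 1
    \<comment> \<open>Both neighbours lie at distance 1, whereas \<open>rec\<close> at 0 involves
      \<open>h (0 - 1)\<close>. Replacing that value by \<open>h 1 + 2\<close> leaves the unit
      mass.\<close>
    have "2 * ((1 + \<alpha>) * h 0) = 2 * (1 + h 1)"
      using rec[of 0] jump by (simp add: algebra_simps)
    then have "(1 + \<alpha>) * h 0 - (h 1 + h 1) / 2 = 1"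
      by (simp only: mult_cancel_left) simp
    then show ?thesis unfolding S P using 1 by (simp add: H)
  next
    case 2
    then have d: "\<bar>int z + 1 - int x\<bar> = k + 1" "\<bar>int z - 1 - int x\<bar> = k - 1" by (auto simp: k_def)
    show ?thesis unfolding S P unfolding d H k_def[symmetric] rec using 2 by simp
  next
    case 3
    then have d: "\<bar>int z + 1 - int x\<bar> = k - 1" "\<bar>int z - 1 - int x\<bar> = k + 1" by (auto simp: k_def)
    show ?thesis unfolding S P unfolding d H k_def[symmetric] add.commute[of "h (k - 1)"] rec using 3 by simp
  qed
qed

section \<open>Spectral expansion of the kernel and removal of the zero mode\<close>

theorem theorem13:
  fixes m x y :: nat
    and \<mu> :: "nat \<Rightarrow> real" and \<phi> :: "nat \<Rightarrow> complex vec"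
    and \<alpha> r s :: complex
  assumes "m \<ge> 3"
    and "orthonormal_eigensystem (cycle_laplacian m) \<mu> \<phi>"
    and "\<alpha> \<noteq> 0"
    and "r \<noteq> 0"
    and "2 * (1 + \<alpha>) = r + inverse r"
    and "s ^ 2 = r"
    and "r - inverse r \<noteq> 0"
    and "s powi int m - s powi (- int m) \<noteq> 0"
    and "x \<le> m - 1" and "y \<le> m - 1"
  shows "gen_green m \<mu> \<phi> \<alpha> $$ (x, y) =
    - (2 / (of_nat m * (r + inverse r - 2))) +
    2 * (s powi (int m - 2 * \<bar>int x - int y\<bar>) + s powi (- int m + 2 * \<bar>int x - int y\<bar>)) /
      ((r - inverse r) * (s powi int m - s powi (- int m)))"
proof -
  let ?L = "cycle_laplacian m" and ?H = "cycle_resolvent m s"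
  have m0: "m > 0" and x: "x < m" and y: "y < m" using assms by auto
  have s0: "s \<noteq> 0" using assms by auto
  have dim: "dim_row ?L = m" "dim_col ?L = m" by (auto simp: cycle_laplacian_def)
  have eig: "eigenvector ?L (\<phi> j) (complex_of_real (\<mu> j))" if "j < m" for j
    using assms(2) that by (simp add: orthonormal_eigensystem_def dim)
  have car: "\<phi> j \<in> carrier_vec m" and nz: "\<phi> j \<noteq> 0\<^sub>v m" if "j < m" for j
    using eig[OF that] by (auto simp: eigenvector_def dim)
  have orth: "\<phi> i \<bullet>c \<phi> j = (if i = j then 1 else 0)" if "i < m" "j < m" for i j
    using assms(2) that by (simp add: orthonormal_eigensystem_def dim)
  note complete = orthonormal_family_complete[of m \<phi>, OF car orth]
  have ev: "(\<Sum>z<m. ?L $$ (w, z) * \<phi> j $ z) = \<mu> j * \<phi> j $ w" if "j < m" "w < m" for j w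
  proof -
    have "(?L *\<^sub>v \<phi> j) $ w = (of_real (\<mu> j) \<cdot>\<^sub>v \<phi> j) $ w"
      using eig[OF \<open>j < m\<close>] by (simp add: eigenvector_def)
    then show ?thesis
      using that car[OF \<open>j < m\<close>] by (simp add: dim scalar_prod_def atLeast0LessThan)
  qed
  \<comment> \<open>The pairing is bilinear, without conjugation, so symmetry of \<open>L\<close>
    suffices to move it from \<open>\<phi> j\<close> to an arbitrary \<open>g\<close>.\<close>
  have sym: "(\<Sum>w<m. g w * (\<mu> j * \<phi> j $ w)) = (\<Sum>z<m. (\<Sum>w<m. ?L $$ (z, w) * g w) * \<phi> j $ z)"
    if "j < m" for j g
  proof -
    have "(\<Sum>w<m. g w * (\<mu> j * \<phi> j $ w)) = (\<Sum>w<m. \<Sum>z<m. g w * (?L $$ (w, z) * \<phi> j $ z))"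
      using ev[OF that] by (simp add: sum_distrib_left[symmetric])
    also have "\<dots> = (\<Sum>z<m. \<Sum>w<m. g w * (?L $$ (w, z) * \<phi> j $ z))"
      by (rule sum.swap)
    also have "\<dots> = (\<Sum>z<m. (\<Sum>w<m. ?L $$ (z, w) * g w) * \<phi> j $ z)"
      by (auto simp: sum_distrib_right cycle_laplacian_sym[of _ m] intro!: sum.cong)
    finally show ?thesis .
  qed
  have inv: "(\<mu> j + \<alpha>) * (\<Sum>z<m. ?H w z * \<phi> j $ z) = \<phi> j $ w" if "j < m" "w < m" for j w
  proof -
    have "(\<mu> j + \<alpha>) * (\<Sum>z<m. ?H w z * \<phi> j $ z) =
        (\<Sum>z<m. ?H w z * (\<mu> j * \<phi> j $ z)) + (\<Sum>z<m. \<alpha> * ?H w z * \<phi> j $ z)"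
      by (simp add: algebra_simps sum_distrib_left sum.distrib)
    also have "\<dots> = (\<Sum>z<m. ((\<Sum>v<m. ?L $$ (z, v) * ?H w v) + \<alpha> * ?H w z) * \<phi> j $ z)"
      unfolding sym[OF \<open>j < m\<close>] by (simp add: algebra_simps sum.distrib)
    also have "\<dots> = (\<Sum>z<m. (if z = w then 1 else 0) * \<phi> j $ z)"
    proof (intro sum.cong refl, goal_cases)
      case (1 z)
      then have z: "z < m" by simp
      have "(\<Sum>v<m. ?L $$ (z, v) * ?H w v) + \<alpha> * ?H w z = (1 + \<alpha>) * ?H w z
          - (?H w ((z + 1) mod m) + ?H w ((z + m - 1) mod m)) / 2"
        unfolding cycle_laplacian_row_sum[OF assms(1) z] by (simp add: algebra_simps)
      also have "\<dots> = (if z = w then 1 else 0)"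
        by (rule cycle_resolvent_equation[OF \<open>w < m\<close> z s0]) (use assms in simp_all)
      finally show ?case by simp
    qed
    also have "\<dots> = \<phi> j $ w"
      using that by (simp add: if_distrib[of "\<lambda>t. t * _"] cong: if_cong)
    finally show ?thesis .
  qed
  \<comment> \<open>That \<open>- \<alpha>\<close> is not an eigenvalue is derived rather than
    assumed: otherwise \<open>inv\<close>, which is stated without division, would force
    \<open>\<phi> j = 0\<close>.\<close>
  have den: "of_real (\<mu> j) + \<alpha> \<noteq> 0" if "j < m" for j
  proof
    assume "of_real (\<mu> j) + \<alpha> = 0"
    then have "\<phi> j $ w = 0" if "w < m" for w
      using inv[OF \<open>j < m\<close> that] by simp
    then have "\<phi> j = 0\<^sub>v m" using car[OF that] by (intro eq_vecI) auto
    with nz[OF that] show False by simp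
  qed
  have const: "\<phi> j $ w = \<phi> j $ 0" if "j < m" "\<mu> j \<le> 0" "w < m" for j w
  proof (rule cycle_nonpos_eigenfunction_constant[OF m0 that(2) _ that(3)])
    fix v assume v: "v < m"
    show "\<phi> j $ v - (\<phi> j $ ((v + 1) mod m) + \<phi> j $ ((v + m - 1) mod m)) / 2 = \<mu> j * \<phi> j $ v"
      using cycle_laplacian_row_sum[OF assms(1) v, of "\<lambda>w. \<phi> j $ w"] ev[OF that(1) v] by simp
  qed
  have mu0: "\<mu> j = 0" if "j < m" "\<mu> j \<le> 0" for j
  proof (rule ccontr)
    assume ne: "\<mu> j \<noteq> 0"
    have "of_real (\<mu> j) * \<phi> j $ 0 = (\<Sum>z<m. ?L $$ (0, z) * \<phi> j $ 0)"
      unfolding ev[OF that(1) m0, symmetric]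
      by (intro sum.cong refl arg_cong[of _ _ "\<lambda>t. _ * t"] const[OF that]) simp
    also have "\<dots> = 0" by (subst cycle_laplacian_row_sum[OF assms(1) m0]) simp
    finally have "\<phi> j $ 0 = 0" using ne by simp
    then have "\<phi> j $ w = 0" if "w < m" for w
      using const[OF \<open>j < m\<close> \<open>\<mu> j \<le> 0\<close> that] by simp
    then have "\<phi> j = 0\<^sub>v m" using car[OF that(1)] by (intro eq_vecI) auto
    with nz[OF that(1)] show False by simp
  qed
  \<comment> \<open>Taking the constant 1 for \<open>g\<close> in \<open>sym\<close> works because
    the rows of \<open>L\<close> sum to zero.\<close>
  have mean: "(\<Sum>z<m. \<phi> j $ z) = 0" if "j < m" "\<mu> j > 0" for j
  proof -
    have "of_real (\<mu> j) * (\<Sum>z<m. \<phi> j $ z) = (\<Sum>z<m. (\<Sum>w<m. ?L $$ (z, w) * 1) * \<phi> j $ z)"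
      using sym[OF that(1), of "\<lambda>_. 1"] by (simp add: sum_distrib_left)
    also have "\<dots> = 0"
      by (intro sum.neutral ballI) (subst cycle_laplacian_row_sum[OF assms(1)], auto)
    finally show ?thesis using that by simp
  qed
  let ?P = "{j. j < m \<and> \<mu> j > 0}" and ?N = "{j. j < m \<and> \<mu> j \<le> 0}"
  have split: "(\<Sum>j<m. g j) = (\<Sum>j\<in>?P. g j) + (\<Sum>j\<in>?N. g j)" for g :: "nat \<Rightarrow> complex"
    by (subst sum.union_disjoint[symmetric]) (auto intro!: sum.cong)
  \<comment> \<open>The multiplicity of the eigenvalue 0 need not be counted. Summing completeness
    over the second vertex kills the positive modes by \<open>mean\<close>, and for the constant
    modes it gives \<open>m\<close> times the value at \<open>y\<close>.\<close>
  have proj: "of_nat m * (\<Sum>j\<in>?N. \<phi> j $ x * cnj (\<phi> j $ y)) = 1"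
  proof -
    have "1 = (\<Sum>z<m. \<Sum>j<m. \<phi> j $ x * cnj (\<phi> j $ z))"
      using x complete by simp
    also have "\<dots> = (\<Sum>j<m. \<phi> j $ x * cnj (\<Sum>z<m. \<phi> j $ z))"
      by (subst sum.swap) (simp add: sum_distrib_left)
    also have "\<dots> = (\<Sum>j\<in>?N. \<phi> j $ x * cnj (\<Sum>z<m. \<phi> j $ z))"
      by (subst split) (simp add: mean del: cnj_sum)
    also have "\<dots> = (\<Sum>j\<in>?N. \<phi> j $ x * (of_nat m * cnj (\<phi> j $ y)))"
    proof (intro sum.cong refl, goal_cases)
      case (1 j)
      then have "(\<Sum>z<m. \<phi> j $ z) = (\<Sum>z<m. \<phi> j $ y)"
        by (intro sum.cong refl) (metis (mono_tags) const lessThan_iff mem_Collect_eq y)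
      then show ?case by simp
    qed
    finally show ?thesis by (simp add: sum_distrib_left mult_ac)
  qed
  \<comment> \<open>Inserting the resolution of the identity lets the kernel act on each
    \<open>\<phi> j\<close>, where \<open>inv\<close> evaluates it.\<close>
  have "?H x y = (\<Sum>z<m. ?H x z * (\<Sum>j<m. \<phi> j $ z * cnj (\<phi> j $ y)))"
    using y by (simp add: complete if_distrib[of "\<lambda>t. _ * t"] cong: if_cong)
  also have "\<dots> = (\<Sum>j<m. (\<Sum>z<m. ?H x z * \<phi> j $ z) * cnj (\<phi> j $ y))"
    unfolding sum_distrib_left sum_distrib_right by (subst sum.swap) (simp add: mult_ac)
  also have "\<dots> = (\<Sum>j<m. 1 / (\<mu> j + \<alpha>) * \<phi> j $ x * cnj (\<phi> j $ y))"
  proof (intro sum.cong refl, goal_cases)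
    case (1 j)
    then have "(\<Sum>z<m. ?H x z * \<phi> j $ z) = 1 / (\<mu> j + \<alpha>) * \<phi> j $ x"
      using inv[of j x] den[of j] x by (simp add: nonzero_eq_divide_eq mult.commute)
    then show ?case by simp
  qed
  also have "\<dots> = gen_green m \<mu> \<phi> \<alpha> $$ (x, y) + (\<Sum>j\<in>?N. 1 / (\<mu> j + \<alpha>) * \<phi> j $ x * cnj (\<phi> j $ y))"
    by (subst split) (use x y in \<open>simp add: gen_green_def\<close>)
  also have "(\<Sum>j\<in>?N. 1 / (\<mu> j + \<alpha>) * \<phi> j $ x * cnj (\<phi> j $ y)) =
      (\<Sum>j\<in>?N. \<phi> j $ x * cnj (\<phi> j $ y)) / \<alpha>"
    unfolding sum_divide_distrib using mu0 by (intro sum.cong refl) simp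
  also have "(\<Sum>j\<in>?N. \<phi> j $ x * cnj (\<phi> j $ y)) / \<alpha> = 2 / (of_nat m * (r + inverse r - 2))"
  proof -
    have "(\<Sum>j\<in>?N. \<phi> j $ x * cnj (\<phi> j $ y)) = 1 / of_nat m"
      using proj m0 by (simp add: nonzero_eq_divide_eq mult.commute)
    moreover have "r + inverse r - 2 = 2 * \<alpha>" using assms(5) by (simp add: algebra_simps)
    ultimately show ?thesis by simp
  qed
  finally show ?thesis
    unfolding cycle_resolvent_def \<open>s ^ 2 = r\<close> by (simp add: algebra_simps)
qed

end
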